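(* Let $k$ be an even positive integer. Then $\mathcal{G}(\mathcal{P}_{1,0}(3k,k))=0$.
   Context: Toggle: Let $G$ be a finite simple graph, with $N[v]$ the closed neighborhood of $v$. A position $\{G,V_0\}$ consists of $G$ and a set $V_0\subseteq V(G)$ of vertices of weight $0$; all other vertices have weight $1$. Let $\sigma(v)$ be the sum of the weights of the vertices in $N[v]$. A legal move consists of choosing a vertex $v$ of weight $1$ and switching the weight ($0\leftrightarrow 1$) of every vertex of $N[v]$; it is allowed only if $\sigma(v)$ after the switch is strictly smaller than $\sigma(v)$ before it. Two players alternate legal moves; a player with no legal move loses. Nimbers: $\mathcal{G}(\mathcal{S})=\mathrm{mex}\{\mathcal{G}(\mathcal{S}') : \mathcal{S}' \text{ reachable from } \mathcal{S} \text{ by one legal move}\}$, where $\mathrm{mex}(T)$ is the least nonnegative integer not in the finite set $T$ (so $\mathrm{mex}(\emptyset)=0$). The generalized Petersen graph $P(m,k)$ has inner vertices $v_{0,1},\dots,v_{0,m}$ and outer vertices $v_{1,1},\dots,v_{1,m}$ (second indices modulo $m$), with edges $v_{1,i}v_{1,i+1}$, $v_{0,i}v_{0,i+k}$ and $v_{0,i}v_{1,i}$ for all $i$. $\mathcal{P}_{1,0}(m,k)$ is the position on $P(m,k)$ in which all inner vertices have weight $1$ and all outer vertices have weight $0$. *)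

theory Defs
  imports "Graph_Theory.Pair_Digraph"
begin

section \<open>Toggle positions\<close>

text \<open>
  A finite simple graph is a symmetric loop-free digraph, i.e. the locale \<^locale>\<open>pair_graph\<close>.
  The pair \<open>(G, V0)\<close> stands for the position \<open>{G, V0}\<close>, where \<open>V0\<close> is the
  set of vertices of weight 0.
\<close>

type_synonym 'a position = "'a pair_pre_digraph \<times> 'a set"

definition valid_position :: "'a position \<Rightarrow> bool" where
  "valid_position = (\<lambda>(G, V0). pair_graph G \<and> V0 \<subseteq> pverts G)"

definition closed_nbhd :: "'a pair_pre_digraph \<Rightarrow> 'a \<Rightarrow> 'a set" where
  "closed_nbhd G v = insert v {u. (v, u) \<in> parcs G}"

definition weight :: "'a set \<Rightarrow> 'a \<Rightarrow> nat" where
  "weight V0 v = (if v \<in> V0 then 0 else 1)"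

definition sigma :: "'a pair_pre_digraph \<Rightarrow> 'a set \<Rightarrow> 'a \<Rightarrow> nat" where
  "sigma G V0 v = (\<Sum>u\<in>closed_nbhd G v. weight V0 u)"

text \<open>Switching the weights on \<open>N[v]\<close> replaces \<open>V0\<close> by its symmetric difference with \<open>N[v]\<close>.\<close>

definition switch :: "'a pair_pre_digraph \<Rightarrow> 'a set \<Rightarrow> 'a \<Rightarrow> 'a set" where
  "switch G V0 v = (V0 - closed_nbhd G v) \<union> (closed_nbhd G v - V0)"

inductive legal_move :: "'a position \<Rightarrow> 'a position \<Rightarrow> bool" where
  "\<lbrakk>v \<in> pverts G; weight V0 v = 1; sigma G (switch G V0 v) v < sigma G V0 v\<rbrakk>
   \<Longrightarrow> legal_move (G, V0) (G, switch G V0 v)"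

section \<open>Nimbers\<close>

definition mex :: "nat set \<Rightarrow> nat" where
  "mex T = (LEAST n. n \<notin> T)"

text \<open>
  The recursion terminates on every valid position, but not provably for malformed graphs, so
  \<open>nimber\<close> is a partial function; the unconditional recursion equation on valid
  positions is \<open>nimber_eq\<close> below.
\<close>

function (domintros) nimber :: "'a position \<Rightarrow> nat" where
  "nimber S = mex (nimber ` {S'. legal_move S S'})"
  by pat_completeness auto

lemma switch_weight: "weight (switch G V0 v) u =
    (if u \<in> closed_nbhd G v then 1 - weight V0 u else weight V0 u)"
  by (auto simp: switch_def weight_def)

lemma closed_nbhd_subset: "pair_graph G \<Longrightarrow> v \<in> pverts G \<Longrightarrow> closed_nbhd G v \<subseteq> pverts G"
  by (auto simp: closed_nbhd_def pair_graph_def pair_digraph_def pair_fin_digraph_def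
      dest: pair_wf_digraph.in_arcsD2)

lemma finite_pverts: "pair_graph G \<Longrightarrow> finite (pverts G)"
  by (simp add: pair_graph_def pair_digraph_def pair_fin_digraph.pair_finite_verts)

lemma legal_move_valid:
  assumes "legal_move S S'" "valid_position S"
  shows "valid_position S'"
  using assms
  by cases (auto simp: valid_position_def switch_def dest: subsetD[OF closed_nbhd_subset])

definition total_weight :: "'a position \<Rightarrow> nat" where
  "total_weight = (\<lambda>(G, V0). \<Sum>u\<in>pverts G. weight V0 u)"

lemma legal_move_decreases:
  assumes "legal_move S S'" "valid_position S"
  shows "total_weight S' < total_weight S"
  using assms
proof cases
  case (1 v G V0)
  have G: "pair_graph G" using 1 assms by (simp add: valid_position_def)
  let ?N = "closed_nbhd G v"
  have sub: "?N \<subseteq> pverts G" and fin: "finite (pverts G)"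
    using closed_nbhd_subset[OF G] finite_pverts[OF G] 1 by auto
  have split: "(\<Sum>u\<in>pverts G. weight W u) = (\<Sum>u\<in>pverts G - ?N. weight W u) + sigma G W v" for W
    unfolding sigma_def by (rule sum.subset_diff[OF sub fin])
  have "(\<Sum>u\<in>pverts G - ?N. weight (switch G V0 v) u) = (\<Sum>u\<in>pverts G - ?N. weight V0 u)"
    by (rule sum.cong) (auto simp: switch_weight)
  with 1 split[of V0] split[of "switch G V0 v"] show ?thesis
    by (simp add: total_weight_def)
qed

lemma nimber_dom: "valid_position S \<Longrightarrow> nimber_dom S"
proof (induction "total_weight S" arbitrary: S rule: less_induct)
  case less
  show ?case
    by (rule nimber.domintros)
      (use less legal_move_valid legal_move_decreases in blast)
qed

lemma nimber_eq: "valid_position S \<Longrightarrow> nimber S = mex {nimber S' | S'. legal_move S S'}"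
  by (simp only: nimber.psimps[OF nimber_dom] image_Collect)

section \<open>Generalized Petersen graphs\<close>

text \<open>
  The vertex \<open>(a, i)\<close> is \<open>v_{a,i}\<close>: inner for \<open>a = 0\<close>, outer for
  \<open>a = 1\<close>. Second indices are represented by their residues \<open>0, ..., m - 1\<close>,
  so \<open>v_{a,m}\<close> is \<open>(a, 0)\<close>.
\<close>

definition petersen_edges :: "nat \<Rightarrow> nat \<Rightarrow> (nat \<times> nat) rel" where
  "petersen_edges m k =
     {((1, i), (1, (i + 1) mod m)) | i. i < m}
   \<union> {((0, i), (0, (i + k) mod m)) | i. i < m}
   \<union> {((0, i), (1, i)) | i. i < m}"

definition gen_petersen :: "nat \<Rightarrow> nat \<Rightarrow> (nat \<times> nat) pair_pre_digraph" where
  "gen_petersen m k =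
    \<lparr> pverts = {0, 1} \<times> {..<m}, parcs = petersen_edges m k \<union> (petersen_edges m k)\<inverse> \<rparr>"

definition petersen_position_1_0 :: "nat \<Rightarrow> nat \<Rightarrow> (nat \<times> nat) position" where
  "petersen_position_1_0 m k = (gen_petersen m k, {(1, i) | i. i < m})"

lemma mod_add_neq_self:
  fixes i k m :: nat
  assumes "i < m" "0 < k" "k < m"
  shows "(i + k) mod m \<noteq> i"
  using assms by (cases "i + k < m") (auto simp: mod_if)

lemma pair_graph_gen_petersen:
  assumes "0 < k" "k < m"
  shows "pair_graph (gen_petersen m k)"
proof -
  have m: "0 < m" "1 < m" using assms by auto
  have sub: "petersen_edges m k \<subseteq> ({0, 1} \<times> {..<m}) \<times> ({0, 1} \<times> {..<m})"
    using m by (auto simp: petersen_edges_def)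
  have fin: "finite (petersen_edges m k)"
    by (rule finite_subset[OF sub]) simp
  have loop: "(x, x) \<notin> petersen_edges m k" for x
    using mod_add_neq_self[of _ m k] mod_add_neq_self[of _ m 1] assms m
    by (cases x) (fastforce simp: petersen_edges_def)
  show ?thesis
  proof unfold_locales
    show "symmetric (with_proj (gen_petersen m k))"
      by (auto simp: symmetric_def gen_petersen_def intro: symI)
  qed (use sub fin loop in \<open>auto simp: gen_petersen_def\<close>)
qed

lemma valid_petersen_position_1_0:
  "0 < k \<Longrightarrow> k < m \<Longrightarrow> valid_position (petersen_position_1_0 m k)"
  using pair_graph_gen_petersen[of k m]
  by (auto simp: valid_position_def petersen_position_1_0_def gen_petersen_def)

end

theory Submission
  imports Defs
begin

text \<open>
  The second player wins by symmetry. For even \<open>k\<close> the rotation by \<open>3k/2\<close> is an involutive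
  automorphism of \<open>P(3k,k)\<close> that preserves the starting position and moves every vertex to
  distance at least 3. A move at \<open>v\<close> therefore does not touch the closed neighbourhood of the
  image \<open>v'\<close> of \<open>v\<close>, so it can be answered at \<open>v'\<close>, which restores the symmetry.
\<close>

lemma mex_eq_0_iff:
  assumes "finite T"
  shows "mex T = 0 \<longleftrightarrow> 0 \<notin> T"
proof
  \<comment> \<open>Finiteness supplies a number outside \<open>T\<close>; without one,
    \<open>LEAST\<close> would be unspecified.\<close>
  obtain n where "n \<notin> T"
    using assms infinite_UNIV_nat by (metis UNIV_I finite_subset subsetI)
  then have "mex T \<notin> T"
    unfolding mex_def by (rule LeastI)
  then show "mex T = 0 \<Longrightarrow> 0 \<notin> T"
    by simp
qed (simp add: mex_def)

lemma finite_legal_moves: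
  assumes "valid_position S"
  shows "finite {S'. legal_move S S'}"
proof (cases S)
  case (Pair G V0)
  have "{S'. legal_move S S'} \<subseteq> (\<lambda>v. (G, switch G V0 v)) ` pverts G"
    by (auto simp: Pair elim: legal_move.cases)
  moreover have "finite (pverts G)"
    using assms by (simp add: Pair valid_position_def finite_pverts)
  ultimately show ?thesis
    by (meson finite_imageI finite_subset)
qed

lemma nimber_eq_0_iff:
  assumes "valid_position S"
  shows "nimber S = 0 \<longleftrightarrow> (\<forall>S'. legal_move S S' \<longrightarrow> nimber S' \<noteq> 0)"
proof -
  have "finite {nimber S' | S'. legal_move S S'}"
    using finite_legal_moves[OF assms] by (rule finite_image_set)
  from mex_eq_0_iff[OF this] show ?thesis
    by (force simp: nimber_eq[OF assms])
qed

lemma switch_other: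
  "closed_nbhd G v \<inter> closed_nbhd G w = {} \<Longrightarrow> u \<in> closed_nbhd G w \<Longrightarrow>
    u \<in> switch G V v \<longleftrightarrow> u \<in> V"
  by (auto simp: switch_def)

text \<open>Mirror strategy for an arbitrary graph, by induction on total weight: each option
  \<open>V1\<close> of a symmetric position has a lighter symmetric option \<open>V2\<close>, of
  nimber 0 by induction, so \<open>V1\<close> has nonzero nimber. Preserving arcs in one direction
  is enough, as \<open>f\<close> is its own inverse.\<close>

lemma symmetric_position_nimber:
  assumes G: "pair_graph G"
    and closed: "\<And>v. v \<in> pverts G \<Longrightarrow> f v \<in> pverts G"
    and invol: "\<And>v. v \<in> pverts G \<Longrightarrow> f (f v) = v"
    and arcs: "\<And>u v. (u, v) \<in> parcs G \<Longrightarrow> (f u, f v) \<in> parcs G"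
    and disj: "\<And>v. v \<in> pverts G \<Longrightarrow> closed_nbhd G v \<inter> closed_nbhd G (f v) = {}"
    and V0: "V0 \<subseteq> pverts G"
    and sym: "\<And>v. v \<in> pverts G \<Longrightarrow> f v \<in> V0 \<longleftrightarrow> v \<in> V0"
  shows "nimber (G, V0) = 0"
  using V0 sym
proof (induction "total_weight (G, V0)" arbitrary: V0 rule: less_induct)
  case less
  have valid: "valid_position (G, V0)"
    using G less.prems(1) by (simp add: valid_position_def)
  have nbhd_image: "f u \<in> closed_nbhd G (f v)" if "u \<in> closed_nbhd G v" for u v
    using that arcs by (auto simp: closed_nbhd_def)
  have nbhd_iff: "f u \<in> closed_nbhd G v \<longleftrightarrow> u \<in> closed_nbhd G (f v)"
    if "u \<in> pverts G" "v \<in> pverts G" for u v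
    using that nbhd_image[of u "f v"] nbhd_image[of "f u" v] invol by auto
  have "nimber S' \<noteq> 0" if "legal_move (G, V0) S'" for S'
    using that
  proof cases
    case (1 v)
    define V1 where "V1 = switch G V0 v"
    define V2 where "V2 = switch G V1 (f v)"
    have v: "v \<in> pverts G" and fv: "f v \<in> pverts G"
      using 1 closed by auto
    note sub = closed_nbhd_subset[OF G v] closed_nbhd_subset[OF G fv]
    have bij: "bij_betw f (closed_nbhd G v) (closed_nbhd G (f v))"
      using sub nbhd_image[of _ v] nbhd_image[of _ "f v"] invol v
      by (intro bij_betw_byWitness[where f' = f]) (auto dest!: subsetD)
    \<comment> \<open>Two sets \<open>W\<close> and \<open>W'\<close> are allowed because the reply
      is compared with the first move one step earlier: first \<open>V1\<close> with
      \<open>V0\<close>, then \<open>V2\<close> with \<open>V1\<close>.\<close>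
    have sigma_f: "sigma G W (f v) = sigma G W' v"
      if "\<And>u. u \<in> closed_nbhd G v \<Longrightarrow> f u \<in> W \<longleftrightarrow> u \<in> W'" for W W'
      unfolding sigma_def sum.reindex_bij_betw[OF bij, symmetric]
      by (rule sum.cong) (simp_all add: weight_def that)
    have V1_fv: "u \<in> V1 \<longleftrightarrow> u \<in> V0" if "u \<in> closed_nbhd G (f v)" for u
      unfolding V1_def by (rule switch_other[OF disj[OF v] that])
    have V1_f: "f u \<in> V1 \<longleftrightarrow> u \<in> V0" if "u \<in> closed_nbhd G v" for u
      using that V1_fv nbhd_image less.prems(2) sub by blast
    have "sigma G V1 (f v) = sigma G V0 v"
      by (rule sigma_f) (rule V1_f)
    moreover have "sigma G V2 (f v) = sigma G V1 v"
      using nbhd_image V1_f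
      by (intro sigma_f) (auto simp: V2_def V1_def switch_def)
    moreover have "weight V1 (f v) = 1"
      using 1 V1_f[of v] by (simp add: weight_def closed_nbhd_def)
    \<comment> \<open>Around \<open>f v\<close> the reply sees the mirror image of what the first
      move saw around \<open>v\<close>, so \<open>sigma\<close> drops by the same amount.\<close>
    ultimately have move2: "legal_move (G, V1) (G, V2)"
      using 1 fv unfolding V2_def by (intro legal_move.intros) (auto simp: V1_def)
    have move1: "legal_move (G, V0) (G, V1)"
      using that 1 by (simp add: V1_def)
    have valid1: "valid_position (G, V1)" and valid2: "valid_position (G, V2)"
      using legal_move_valid move1 move2 valid by blast+
    have "nimber (G, V2) = 0"
    proof (rule less.hyps)
      show "total_weight (G, V2) < total_weight (G, V0)"
        using legal_move_decreases move1 move2 valid valid1 by (meson less_trans)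
      show "V2 \<subseteq> pverts G"
        using valid2 by (simp add: valid_position_def)
      \<comment> \<open>\<open>V2\<close> is \<open>V0\<close> switched on both neighbourhoods, and
        \<open>f\<close> interchanges these.\<close>
      show "f u \<in> V2 \<longleftrightarrow> u \<in> V2" if "u \<in> pverts G" for u
        using that less.prems(2)[OF that] nbhd_iff[OF that v] nbhd_iff[OF that fv] invol[OF v]
        by (auto simp: V2_def V1_def switch_def)
    qed
    then show ?thesis
      using move2 nimber_eq_0_iff[OF valid1] 1 by (auto simp: V1_def)
  qed
  then show ?case
    using nimber_eq_0_iff[OF valid] by blast
qed

definition rotate_index :: "nat \<Rightarrow> nat \<Rightarrow> nat \<times> nat \<Rightarrow> nat \<times> nat" where
  "rotate_index m d = (\<lambda>(a, i). (a, (i + d) mod m))"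

text \<open>Adding \<open>d\<close> modulo \<open>m\<close> commutes with the shifts by 1 and
  \<open>k\<close> that define the edges.\<close>

lemma petersen_edges_rotate:
  assumes "(u, v) \<in> petersen_edges m k"
  shows "(rotate_index m d u, rotate_index m d v) \<in> petersen_edges m k"
proof -
  have comm: "((i + c) mod m + d) mod m = ((i + d) mod m + c) mod m" for i c
    by (simp add: mod_simps ac_simps)
  from assms consider
      i where "i < m" "u = (1, i)" "v = (1, (i + 1) mod m)"
    | i where "i < m" "u = (0, i)" "v = (0, (i + k) mod m)"
    | i where "i < m" "u = (0, i)" "v = (1, i)"
    unfolding petersen_edges_def by blast
  then show ?thesis
    by cases (auto simp: rotate_index_def petersen_edges_def comm[of _ 1, simplified] comm[of _ k]
        intro!: exI[of _ "(_ + d) mod m"])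
qed

lemma gen_petersen_arcs_rotate:
  "(u, v) \<in> parcs (gen_petersen m k) \<Longrightarrow>
    (rotate_index m d u, rotate_index m d v) \<in> parcs (gen_petersen m k)"
  by (auto simp: gen_petersen_def petersen_edges_rotate)

lemma disjoint_mono: "A \<subseteq> A' \<Longrightarrow> B \<subseteq> B' \<Longrightarrow> A' \<inter> B' = {} \<Longrightarrow> A \<inter> B = {}"
  by blast

text \<open>With \<open>k = 2 * j\<close> the half turn is \<open>3 * j\<close>. Inner neighbours
  differ in index by multiples of \<open>2 * j\<close> modulo \<open>6 * j\<close>, and
  \<open>3 * j\<close> is not one. Outer neighbourhoods reach one step each way, while the half turn
  moves an index by at least 3 in either direction.\<close>

lemma half_turn_nbhd_disjoint:
  fixes j :: nat
  assumes "0 < j" and v: "v \<in> pverts (gen_petersen (6 * j) (2 * j))"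
  shows "closed_nbhd (gen_petersen (6 * j) (2 * j)) v \<inter>
    closed_nbhd (gen_petersen (6 * j) (2 * j)) (rotate_index (6 * j) (3 * j) v) = {}"
proof -
  let ?G = "gen_petersen (6 * j) (2 * j)"
  have mod6: "(i + c) mod (6 * j) = (if i + c < 6 * j then i + c else i + c - 6 * j)"
    if "i < 6 * j" "c \<le> 6 * j" for i c
    using that by (auto simp: mod_if)
  have succ: "Suc i mod (6 * j) = (if Suc i = 6 * j then 0 else Suc i)" if "i < 6 * j" for i
    using that by auto
  have outer: "closed_nbhd ?G (1, i) \<subseteq> {(0, i), (1, i), (1, if Suc i = 6 * j then 0 else Suc i),
      (1, if i = 0 then 6 * j - 1 else i - 1)}" if "i < 6 * j" for i
    using that \<open>0 < j\<close>
    by (auto simp: closed_nbhd_def gen_petersen_def petersen_edges_def succ split: if_splits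
        dest: dvd_imp_le)
  \<comment> \<open>The neighbour at \<open>i - 2 * j\<close> is written as \<open>i + 4 * j\<close>
    modulo \<open>6 * j\<close>, which avoids truncated subtraction.\<close>
  have inner: "closed_nbhd ?G (0, i) \<subseteq> {(1, i), (0, i), (0, (i + 2 * j) mod (6 * j)),
      (0, (i + 4 * j) mod (6 * j))}" if "i < 6 * j" for i
    using that \<open>0 < j\<close>
    by (auto simp: closed_nbhd_def gen_petersen_def petersen_edges_def mod_simps)
  obtain a i where ai: "v = (a, i)" "a = 0 \<or> a = 1" "i < 6 * j"
    using v by (auto simp: gen_petersen_def)
  define i' where "i' = (i + 3 * j) mod (6 * j)"
  \<comment> \<open>Resolving the wraparound here removes \<open>mod\<close> from the relation
    between \<open>i\<close> and \<open>i'\<close> and leaves linear arithmetic.\<close>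
  have i': "i' < 6 * j" "i' = i + 3 * j \<or> i = i' + 3 * j"
    using ai \<open>0 < j\<close> by (auto simp: i'_def mod6)
  show ?thesis
    using ai(2)
  proof
    assume "a = 0"
    have "closed_nbhd ?G (0, i) \<inter> closed_nbhd ?G (0, i') = {}"
      by (rule disjoint_mono[OF inner[OF ai(3)] inner[OF i'(1)]])
        (use ai(3) i' \<open>0 < j\<close> in \<open>auto simp: mod6\<close>)
    then show ?thesis
      by (simp add: ai(1) rotate_index_def i'_def \<open>a = 0\<close>)
  next
    assume "a = 1"
    have "closed_nbhd ?G (1, i) \<inter> closed_nbhd ?G (1, i') = {}"
      by (rule disjoint_mono[OF outer[OF ai(3)] outer[OF i'(1)]])
        (use ai(3) i' \<open>0 < j\<close> in \<open>auto split: if_splits; presburger\<close>)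
    then show ?thesis
      by (simp add: ai(1) rotate_index_def i'_def \<open>a = 1\<close>)
  qed
qed

theorem theorem4p5:
  fixes k :: nat
  assumes "even k" and "0 < k"
  shows "nimber (petersen_position_1_0 (3 * k) k) = 0"
proof -
  obtain j where k: "k = 2 * j"
    using \<open>even k\<close> by (elim evenE)
  with \<open>0 < k\<close> have "0 < j"
    by simp
  let ?G = "gen_petersen (6 * j) (2 * j)" and ?f = "rotate_index (6 * j) (3 * j)"
  have "nimber (?G, {(1, i) | i. i < 6 * j}) = 0"
  proof (rule symmetric_position_nimber[where f = ?f])
    show "pair_graph ?G"
      using \<open>0 < j\<close> by (intro pair_graph_gen_petersen) auto
    show "?f v \<in> pverts ?G" "?f (?f v) = v" if "v \<in> pverts ?G" for v
      using that by (auto simp: gen_petersen_def rotate_index_def mod_simps)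
    show "(?f u, ?f v) \<in> parcs ?G" if "(u, v) \<in> parcs ?G" for u v
      using that by (rule gen_petersen_arcs_rotate)
    show "closed_nbhd ?G v \<inter> closed_nbhd ?G (?f v) = {}" if "v \<in> pverts ?G" for v
      using \<open>0 < j\<close> that by (rule half_turn_nbhd_disjoint)
  qed (auto simp: gen_petersen_def rotate_index_def)
  then show ?thesis
    by (simp add: k petersen_position_1_0_def)
qed

end
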